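(* Let $\mathcal{M}$ be a structure in which all finite sets $\Phi(x;y)$ of formulas with $|x|=1$ admit a distal cell decomposition with $k$ parameters, and suppose that for some $d_0\in\mathbb{N}$, all finite sets $\Phi(x;y)$ of formulas with $|x|=d_0$ admit distal cell decompositions of exponent at most $r$. Then all finite sets $\Phi(x;y)$ of formulas with $|x|=d\ge d_0$ admit distal cell decompositions of exponent $k(d-d_0)+r$.
   Context: Let $\mathcal{M}$ be a first-order structure with universe $M$ in a language $\mathcal{L}$. Formulas are $\mathcal{L}$-formulas without parameters. In a partitioned formula $\varphi(x;y)$ the variables are split into finite tuples $x,y$ of lengths $|x|,|y|$ ($y$ is of arbitrary length); all formulas in a set $\Phi(x;y)$ share the same $x$ and $y$. For $b\in M^{|y|}$ put $\varphi(M^{|x|};b)=\{a\in M^{|x|}:\mathcal{M}\models\varphi(a,b)\}$. For $B\subseteq M^{|y|}$, a set $X\subseteq M^{|x|}$ is crossed by $\Phi(x;B)$ if for some $\varphi\in\Phi$, $b\in B$ both $X\cap\varphi(M^{|x|};b)$ and $X\setminus\varphi(M^{|x|};b)$ are nonempty. A distal cell decomposition $\mathcal{T}$ for a finite set $\Phi(x;y)$ is given by a finite set $\Psi(x;y_1,\dots,y_k)$ of formulas with $|y_1|=\dots=|y_k|=|y|$ and, for each $\psi\in\Psi$, a formula $\theta_\psi(y;y_1,\dots,y_k)$ such that for each finite nonempty $B\subseteq M^{|y|}$ the following holds. Let $\mathcal{T}(B)$ be the set of all $\Delta=\psi(M^{|x|};b_1,\dots,b_k)$ with $\psi\in\Psi$,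 $b_1,\dots,b_k\in B$, such that no $b\in B$ satisfies $\theta_\psi(b;b_1,\dots,b_k)$. Then $\bigcup\mathcal{T}(B)=M^{|x|}$ and no element of $\mathcal{T}(B)$ is crossed by $\Phi(x;B)$. $\mathcal{T}$ has $k$ parameters if every formula in $\Psi$ is of the form $\psi(x;y_1,\dots,y_k)$ (with this $k$). $\mathcal{T}$ has exponent $r$ if there is $C$ with $|\mathcal{T}(B)|\le C|B|^r$ for all finite nonempty $B\subseteq M^{|y|}$. In the hypotheses the numbers $k$, $d_0$, $r$ do not depend on $\Phi$. *)

theory Defs
  imports Complex_Main
begin

section \<open>First-order structures and formulas\<close>

record ('f, 'r) language =
  fun_syms :: "'f set"
  fun_arity :: "'f \<Rightarrow> nat"
  rel_syms :: "'r set"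
  rel_arity :: "'r \<Rightarrow> nat"

text \<open>The universe of a structure is the type \<open>'a\<close>. Interpretations are total on lists; their
  values at symbols outside the language or at lists of the wrong length are never used by
  well-formed formulas.\<close>

record ('f, 'r, 'a) fo_structure = "('f, 'r) language" +
  fun_interp :: "'f \<Rightarrow> 'a list \<Rightarrow> 'a"
  rel_interp :: "'r \<Rightarrow> 'a list \<Rightarrow> bool"

text \<open>Variables are de Bruijn indices: a formula in \<open>n\<close> free variables has the variables
  \<open>Var 0, \<dots>, Var (n - 1)\<close>, and the body of \<open>Ex \<phi>\<close> has one more variable, \<open>Var 0\<close>, which
  shifts the others up by one.\<close>

datatype 'f tm = Var nat | Fun 'f "'f tm list"

datatype ('f, 'r) fm =
    Eq "'f tm" "'f tm"
  | Rel 'r "'f tm list"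
  | Neg "('f, 'r) fm"
  | Conj "('f, 'r) fm" "('f, 'r) fm"
  | Ex "('f, 'r) fm"

fun is_term :: "('f, 'r, 'z) language_scheme \<Rightarrow> nat \<Rightarrow> 'f tm \<Rightarrow> bool" where
  "is_term L n (Var i) \<longleftrightarrow> i < n"
| "is_term L n (Fun f ts) \<longleftrightarrow>
     f \<in> fun_syms L \<and> length ts = fun_arity L f \<and> (\<forall>t\<in>set ts. is_term L n t)"

primrec is_formula :: "('f, 'r, 'z) language_scheme \<Rightarrow> nat \<Rightarrow> ('f, 'r) fm \<Rightarrow> bool" where
  "is_formula L n (Eq s t) \<longleftrightarrow> is_term L n s \<and> is_term L n t"
| "is_formula L n (Rel R ts) \<longleftrightarrow>
     R \<in> rel_syms L \<and> length ts = rel_arity L R \<and> (\<forall>t\<in>set ts. is_term L n t)"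
| "is_formula L n (Neg \<phi>) \<longleftrightarrow> is_formula L n \<phi>"
| "is_formula L n (Conj \<phi> \<psi>) \<longleftrightarrow> is_formula L n \<phi> \<and> is_formula L n \<psi>"
| "is_formula L n (Ex \<phi>) \<longleftrightarrow> is_formula L (Suc n) \<phi>"

primrec tm_val :: "('f, 'r, 'a) fo_structure \<Rightarrow> 'a list \<Rightarrow> 'f tm \<Rightarrow> 'a" where
  "tm_val M e (Var i) = e ! i"
| "tm_val M e (Fun f ts) = fun_interp M f (map (tm_val M e) ts)"

primrec sat :: "('f, 'r, 'a) fo_structure \<Rightarrow> 'a list \<Rightarrow> ('f, 'r) fm \<Rightarrow> bool" where
  "sat M e (Eq s t) \<longleftrightarrow> tm_val M e s = tm_val M e t"
| "sat M e (Rel R ts) \<longleftrightarrow> rel_interp M R (map (tm_val M e) ts)"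
| "sat M e (Neg \<phi>) \<longleftrightarrow> \<not> sat M e \<phi>"
| "sat M e (Conj \<phi> \<psi>) \<longleftrightarrow> sat M e \<phi> \<and> sat M e \<psi>"
| "sat M e (Ex \<phi>) \<longleftrightarrow> (\<exists>a. sat M (a # e) \<phi>)"

section \<open>Distal cell decompositions\<close>

definition tuples :: "nat \<Rightarrow> 'a list set" where
  "tuples n = {a. length a = n}"

text \<open>A partitioned formula \<open>\<phi>(x;y)\<close> with \<open>|x| = m\<close>, \<open>|y| = n\<close> is a formula in \<open>m + n\<close> free
  variables, the first \<open>m\<close> forming \<open>x\<close> and the remaining \<open>n\<close> forming \<open>y\<close>. Likewise
  \<open>\<psi>(x;y\<^sub>1,\<dots>,y\<^sub>k)\<close> is a formula in \<open>m + k * n\<close> free variables.\<close>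

definition is_formula_set ::
  "('f, 'r, 'a) fo_structure \<Rightarrow> nat \<Rightarrow> nat \<Rightarrow> ('f, 'r) fm set \<Rightarrow> bool" where
  "is_formula_set M m n \<Phi> \<longleftrightarrow> finite \<Phi> \<and> (\<forall>\<phi>\<in>\<Phi>. is_formula M (m + n) \<phi>)"

definition def_set ::
  "('f, 'r, 'a) fo_structure \<Rightarrow> nat \<Rightarrow> ('f, 'r) fm \<Rightarrow> 'a list \<Rightarrow> 'a list set" where
  "def_set M m \<phi> b = {a \<in> tuples m. sat M (a @ b) \<phi>}"

definition crossed ::
  "('f, 'r, 'a) fo_structure \<Rightarrow> nat \<Rightarrow> ('f, 'r) fm set \<Rightarrow> 'a list set \<Rightarrow> 'a list set \<Rightarrow> bool" where
  "crossed M m \<Phi> B X \<longleftrightarrow>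
     (\<exists>\<phi>\<in>\<Phi>. \<exists>b\<in>B. X \<inter> def_set M m \<phi> b \<noteq> {} \<and> X - def_set M m \<phi> b \<noteq> {})"

text \<open>The data \<open>(k, \<Psi>, (\<theta>\<^sub>\<psi>)\<^sub>\<psi>)\<close> of a decomposition; \<open>theta\<close> is only relevant on \<open>Psi\<close>.\<close>

record ('f, 'r) cell_decomp =
  params :: nat
  Psi :: "('f, 'r) fm set"
  theta :: "('f, 'r) fm \<Rightarrow> ('f, 'r) fm"

text \<open>The set \<open>\<T>(B)\<close>, as a set of subsets of \<open>M\<^sup>m\<close>; the list \<open>bs\<close> is \<open>(b\<^sub>1,\<dots>,b\<^sub>k)\<close>.\<close>

definition cells ::
  "('f, 'r, 'a) fo_structure \<Rightarrow> nat \<Rightarrow> ('f, 'r) cell_decomp \<Rightarrow> 'a list set \<Rightarrow> 'a list set set" where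
  "cells M m T B =
     {def_set M m \<psi> (concat bs) |\<psi> bs.
        \<psi> \<in> Psi T \<and> length bs = params T \<and> set bs \<subseteq> B \<and>
        \<not> (\<exists>b\<in>B. sat M (b @ concat bs) (theta T \<psi>))}"

definition distal_cell_decomp ::
  "('f, 'r, 'a) fo_structure \<Rightarrow> nat \<Rightarrow> nat \<Rightarrow> ('f, 'r) fm set \<Rightarrow> ('f, 'r) cell_decomp \<Rightarrow> bool" where
  "distal_cell_decomp M m n \<Phi> T \<longleftrightarrow>
     is_formula_set M m (params T * n) (Psi T) \<and>
     (\<forall>\<psi>\<in>Psi T. is_formula M (n + params T * n) (theta T \<psi>)) \<and>
     (\<forall>B. finite B \<and> B \<noteq> {} \<and> B \<subseteq> tuples n \<longrightarrow>
        \<Union> (cells M m T B) = tuples m \<and>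
        (\<forall>\<Delta>\<in>cells M m T B. \<not> crossed M m \<Phi> B \<Delta>))"

definition has_exponent ::
  "('f, 'r, 'a) fo_structure \<Rightarrow> nat \<Rightarrow> nat \<Rightarrow> ('f, 'r) cell_decomp \<Rightarrow> real \<Rightarrow> bool" where
  "has_exponent M m n T r \<longleftrightarrow>
     (\<exists>C::real. \<forall>B. finite B \<and> B \<noteq> {} \<and> B \<subseteq> tuples n \<longrightarrow>
        real (card (cells M m T B)) \<le> C * real (card B) powr r)"

end

theory Submission
  imports Defs
begin

text \<open>
  By induction on \<open>d\<close>, adding one variable at a time. Let \<open>x = (x\<^sub>1, x')\<close> with \<open>|x'| = m\<close>. The
  one-variable hypothesis, applied to \<open>\<phi>(x\<^sub>1; x', y)\<close>, cuts every fibre over \<open>x'\<close> into cells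
  \<open>\<psi>(x\<^sub>1; x', b\<^sub>1, \<dots>, x', b\<^sub>k)\<close> with \<open>b\<^sub>1, \<dots>, b\<^sub>k \<in> B\<close>. Whether such a \<open>\<psi>\<close> occurs at \<open>x'\<close>, and
  whether its fibre is contained in \<open>\<phi>(M; x', b)\<close>, is decided by finitely many formulas in
  \<open>(x'; b, b\<^sub>1, \<dots>, b\<^sub>k)\<close>. With \<open>b\<^sub>1, \<dots>, b\<^sub>k\<close> fixed only \<open>b\<close> varies, so decomposing \<open>M\<^sup>m\<close> over the
  parameter set \<open>B \<times> {(b\<^sub>1, \<dots>, b\<^sub>k)}\<close>, which has only \<open>|B|\<close> elements, costs \<open>O(|B|\<^sup>s)\<close> cells
  when \<open>s\<close> is the exponent available for \<open>m\<close> variables, and the \<open>|B|\<^sup>k\<close> choices of \<open>b\<^sub>1, \<dots>, b\<^sub>k\<close> add \<open>k\<close> to the exponent.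
\<close>

section \<open>Definable predicates\<close>

definition slice :: "nat \<Rightarrow> nat \<Rightarrow> 'a list \<Rightarrow> 'a list" where
  "slice i l e = take l (drop i e)"

text \<open>Substitutions of variables: the output entries are selected input coordinates, in any
  order and with repetition, because base points and parameter blocks get copied. Agreement is asked
  only on \<open>tuples N\<close>, since \<open>slice\<close> and \<open>drop\<close> have this form
  only at a known length.\<close>

definition coord_map :: "nat \<Rightarrow> nat \<Rightarrow> ('a list \<Rightarrow> 'a list) \<Rightarrow> bool" where
  "coord_map N N' f \<longleftrightarrow>
     (\<exists>js. length js = N' \<and> set js \<subseteq> {..<N} \<and> (\<forall>e\<in>tuples N. f e = map ((!) e) js))"

lemma coord_map_id: "coord_map N N (\<lambda>e. e)"
  unfolding coord_map_def by (rule exI[of _ "[0..<N]"]) (auto simp: tuples_def map_nth)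

lemma coord_map_take: "l \<le> N \<Longrightarrow> coord_map N l (take l)"
  unfolding coord_map_def
  by (rule exI[of _ "[0..<l]"]) (auto simp: tuples_def intro!: nth_equalityI)

lemma coord_map_drop: "coord_map (l + N) N (drop l)"
  unfolding coord_map_def
  by (rule exI[of _ "[l..<l+N]"]) (auto simp: tuples_def intro!: nth_equalityI)

lemma coord_map_slice:
  assumes "coord_map N N' f" "i + l \<le> N'"
  shows "coord_map N l (\<lambda>e. slice i l (f e))"
proof -
  from assms(1) obtain js where "length js = N'" "set js \<subseteq> {..<N}"
    "\<forall>e\<in>tuples N. f e = map ((!) e) js" unfolding coord_map_def by blast
  then show ?thesis using assms(2) unfolding coord_map_def slice_def
    by (intro exI[of _ "take l (drop i js)"])
       (auto simp: take_map drop_map dest!: in_set_takeD in_set_dropD)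
qed

lemma coord_map_append:
  assumes "coord_map N l f" "coord_map N l' g"
  shows "coord_map N (l + l') (\<lambda>e. f e @ g e)"
proof -
  from assms obtain ks js where "length ks = l" "set ks \<subseteq> {..<N}"
    "\<forall>e\<in>tuples N. f e = map ((!) e) ks" "length js = l'" "set js \<subseteq> {..<N}"
    "\<forall>e\<in>tuples N. g e = map ((!) e) js" unfolding coord_map_def by blast
  then show ?thesis unfolding coord_map_def by (intro exI[of _ "ks @ js"]) auto
qed

lemma coord_map_concat:
  "(\<And>j. j < k \<Longrightarrow> coord_map N l (f j)) \<Longrightarrow>
    coord_map N (k * l) (\<lambda>e. concat (map (\<lambda>j. f j e) [0..<k]))"
proof (induction k)
  case 0
  then show ?case by (auto simp: coord_map_def)
next
  case (Suc k)
  have "coord_map N (k * l + l) (\<lambda>e. concat (map (\<lambda>j. f j e) [0..<k]) @ f k e)"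
    using Suc by (intro coord_map_append) auto
  then show ?case by (simp add: add.commute)
qed

primrec ren_tm :: "nat list \<Rightarrow> 'f tm \<Rightarrow> 'f tm" where
  "ren_tm js (Var i) = Var (js ! i)"
| "ren_tm js (Fun f ts) = Fun f (map (ren_tm js) ts)"

text \<open>\<open>js ! i\<close> is the new index of variable \<open>i\<close>. Under
  \<open>Ex\<close> the bound variable stays \<open>0\<close> and all other indices move up by
  one.\<close>

primrec ren :: "nat list \<Rightarrow> ('f, 'r) fm \<Rightarrow> ('f, 'r) fm" where
  "ren js (Eq s t) = Eq (ren_tm js s) (ren_tm js t)"
| "ren js (Rel R ts) = Rel R (map (ren_tm js) ts)"
| "ren js (Neg \<phi>) = Neg (ren js \<phi>)"
| "ren js (Conj \<phi> \<psi>) = Conj (ren js \<phi>) (ren js \<psi>)"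
| "ren js (Ex \<phi>) = Ex (ren (0 # map Suc js) \<phi>)"

lemma is_term_ren_tm:
  "is_term L (length js) t \<Longrightarrow> set js \<subseteq> {..<N} \<Longrightarrow> is_term L N (ren_tm js t)"
  by (induction t) (auto simp: subset_iff)

lemma is_formula_ren:
  "is_formula L (length js) \<phi> \<Longrightarrow> set js \<subseteq> {..<N} \<Longrightarrow> is_formula L N (ren js \<phi>)"
proof (induction \<phi> arbitrary: js N)
  case (Ex \<phi>)
  show ?case using Ex.prems Ex.IH[of "0 # map Suc js" "Suc N"] by fastforce
qed (auto intro: is_term_ren_tm)

lemma tm_val_ren_tm:
  "is_term L (length js) t \<Longrightarrow> tm_val M e (ren_tm js t) = tm_val M (map ((!) e) js) t"
  by (induction t) (auto simp: comp_def intro!: arg_cong[where f = "fun_interp M _"])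

lemma sat_ren:
  "is_formula L (length js) \<phi> \<Longrightarrow> sat M e (ren js \<phi>) \<longleftrightarrow> sat M (map ((!) e) js) \<phi>"
proof (induction \<phi> arbitrary: js e)
  case (Rel R ts)
  then have "map (tm_val M e) (map (ren_tm js) ts) = map (tm_val M (map ((!) e) js)) ts"
    by (auto simp: tm_val_ren_tm)
  then show ?case by (simp del: map_map)
next
  case (Ex \<phi>)
  show ?case using Ex.prems Ex.IH[of "0 # map Suc js"] by (simp add: comp_def)
qed (auto simp: tm_val_ren_tm)

text \<open>Reasoning with predicates up to definability spares writing out compound formulas; a
  formula is extracted only when a formula set has to be formed.\<close>

definition definable ::
  "('f, 'r, 'a) fo_structure \<Rightarrow> nat \<Rightarrow> ('a list \<Rightarrow> bool) \<Rightarrow> bool" where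
  "definable M N P \<longleftrightarrow> (\<exists>\<phi>. is_formula M N \<phi> \<and> (\<forall>e\<in>tuples N. sat M e \<phi> \<longleftrightarrow> P e))"

lemma definable_sat:
  assumes "is_formula M N' \<phi>" "coord_map N N' f"
  shows "definable M N (\<lambda>e. sat M (f e) \<phi>)"
proof -
  from assms(2) obtain js where "length js = N'" "set js \<subseteq> {..<N}"
    "\<forall>e\<in>tuples N. f e = map ((!) e) js" unfolding coord_map_def by blast
  then show ?thesis using assms(1) unfolding definable_def
    by (intro exI[of _ "ren js \<phi>"]) (auto simp: sat_ren is_formula_ren)
qed

lemma definable_not: "definable M N P \<Longrightarrow> definable M N (\<lambda>e. \<not> P e)"
  unfolding definable_def by (metis is_formula.simps(3) sat.simps(3))

lemma definable_conj:
  "definable M N P \<Longrightarrow> definable M N Q \<Longrightarrow> definable M N (\<lambda>e. P e \<and> Q e)"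
  unfolding definable_def by (metis is_formula.simps(4) sat.simps(4))

lemma definable_disj:
  "definable M N P \<Longrightarrow> definable M N Q \<Longrightarrow> definable M N (\<lambda>e. P e \<or> Q e)"
  using definable_not[OF definable_conj[OF definable_not definable_not]] by simp

lemma definable_ex:
  assumes "definable M (Suc N) P"
  shows "definable M N (\<lambda>e. \<exists>a. P (a # e))"
proof -
  from assms obtain \<phi> where "is_formula M (Suc N) \<phi>" "\<forall>e\<in>tuples (Suc N). sat M e \<phi> \<longleftrightarrow> P e"
    unfolding definable_def by blast
  then show ?thesis unfolding definable_def by (intro exI[of _ "Ex \<phi>"]) (auto simp: tuples_def)
qed

text \<open>\<open>Ex\<close> binds the first coordinate, so the block in front of \<open>e\<close>
  is quantified away from its head. \<open>P\<close> varies in the induction because it becomes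
  \<open>\<lambda>e. \<exists>a. P (a # e)\<close>.\<close>

lemma definable_bex_append:
  "definable M (m + N) P \<Longrightarrow> definable M N (\<lambda>e. \<exists>x\<in>tuples m. P (x @ e))"
proof (induction m arbitrary: P)
  case 0
  then show ?case by (simp add: tuples_def)
next
  case (Suc m)
  have "definable M N (\<lambda>e. \<exists>x\<in>tuples m. \<exists>a. P (a # x @ e))"
    using Suc.IH[OF definable_ex] Suc.prems by simp
  moreover have "(\<exists>x\<in>tuples m. \<exists>a. P (a # x @ e)) \<longleftrightarrow> (\<exists>x\<in>tuples (Suc m). P (x @ e))" for e
    by (force simp: tuples_def length_Suc_conv)
  ultimately show ?case by simp
qed

text \<open>Shaped for backward application to a bounded quantifier over
  \<open>tuples m\<close>.\<close>

lemma definable_bex: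
  assumes "definable M (m + N) (\<lambda>e. P (take m e) (drop m e))"
  shows "definable M N (\<lambda>e. \<exists>x\<in>tuples m. P x e)"
  using definable_bex_append[OF assms] by (simp add: tuples_def)

section \<open>Lists of tuples\<close>

lemma length_concat_tuples: "set bs \<subseteq> tuples n \<Longrightarrow> length (concat bs) = length bs * n"
  by (induction bs) (auto simp: tuples_def)

text \<open>Decodes parameter tuples from flat environments. Induction from the right moves the last
  block into the suffix \<open>q\<close>, which therefore varies.\<close>

lemma map_slice_concat:
  assumes "set bs \<subseteq> tuples n"
  shows "map (\<lambda>j. slice (length p + j * n) n (p @ concat bs @ q)) [0..<length bs] = bs"
  using assms
proof (induction bs arbitrary: q rule: rev_induct)
  case (snoc b bs)
  then have "length (concat bs) = length bs * n" "length b = n"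
    by (auto simp: length_concat_tuples tuples_def)
  then show ?case using snoc.prems snoc.IH[of "b @ q"] by (simp add: slice_def)
qed simp

lemma map_slice_concat':
  assumes "e = p @ concat bs @ q" "set bs \<subseteq> tuples n" "length p = i" "length bs = k"
  shows "map (\<lambda>j. g (slice (i + j * n) n e)) [0..<k] = map g bs"
proof -
  have "map (\<lambda>j. slice (i + j * n) n e) [0..<k] = bs"
    using map_slice_concat[of bs n p q] assms by simp
  then have "map g (map (\<lambda>j. slice (i + j * n) n e) [0..<k]) = map g bs" by simp
  then show ?thesis by (simp add: comp_def)
qed

lemma block_le: "j < k \<Longrightarrow> j * n + n \<le> k * (n::nat)"
  using mult_le_mono1[of "Suc j" k n] by simp

section \<open>Cells\<close>

lemma not_crossedD:
  assumes "\<not> crossed M m \<Phi> B X" "X \<subseteq> tuples m" "\<phi> \<in> \<Phi>" "b \<in> B" "x \<in> X" "x' \<in> X"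
  shows "sat M (x @ b) \<phi> \<longleftrightarrow> sat M (x' @ b) \<phi>"
  using assms unfolding crossed_def def_set_def by blast

lemma cells_subset: "D \<in> cells M m T B \<Longrightarrow> D \<subseteq> tuples m"
  by (auto simp: cells_def def_set_def)

lemma finite_cells:
  assumes "finite (Psi T)" "finite B"
  shows "finite (cells M m T B)"
proof -
  let ?L = "{bs. set bs \<subseteq> B \<and> length bs = params T}"
  have "cells M m T B \<subseteq> (\<lambda>(\<psi>, bs). def_set M m \<psi> (concat bs)) ` (Psi T \<times> ?L)"
    unfolding cells_def by auto
  moreover have "finite (Psi T \<times> ?L)" using assms finite_lists_length_eq by blast
  ultimately show ?thesis using finite_surj by blast
qed

text \<open>A supply of pairwise distinct sentences for tagging: negations in front of a sentence
  that is valid because a type is nonempty. An even number of negations keeps it true.\<close>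

primrec taut :: "nat \<Rightarrow> ('f, 'r) fm" where
  "taut 0 = Ex (Eq (Var 0) (Var 0))"
| "taut (Suc i) = Neg (taut i)"

lemma taut_inject: "taut i = taut j \<longleftrightarrow> i = j"
proof (induction i arbitrary: j)
  case 0
  show ?case by (cases j) auto
next
  case (Suc i)
  then show ?case by (cases j) auto
qed

lemma is_formula_taut: "is_formula L N (taut i)"
  by (induction i) auto

lemma sat_taut_even: "sat M e (taut (2 * i))"
  by (induction i) auto

text \<open>Lets the data of a decomposition be given by predicates over any finite index set;
  below, the indices are pairs of formulas. Covering and non-crossing are left to be proved from the
  resulting description of the cells.\<close>

lemma cell_decomp_of_family:
  fixes M :: "('f, 'r, 'a) fo_structure"
  assumes "finite I"
    and P: "\<forall>i\<in>I. definable M (m + K * n) (P i)"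
    and Q: "\<forall>i\<in>I. definable M (n + K * n) (Q i)"
  shows "\<exists>T. params T = K \<and> is_formula_set M m (K * n) (Psi T) \<and>
    (\<forall>\<psi>\<in>Psi T. is_formula M (n + K * n) (theta T \<psi>)) \<and>
    (\<forall>B\<subseteq>tuples n. cells M m T B =
       {{a \<in> tuples m. P i (a @ concat bs)} |i bs.
          i \<in> I \<and> length bs = K \<and> set bs \<subseteq> B \<and> \<not> (\<exists>b\<in>B. Q i (b @ concat bs))})"
proof -
  obtain p where p: "\<And>i. i \<in> I \<Longrightarrow> is_formula M (m + K * n) (p i)"
    "\<And>i e. i \<in> I \<Longrightarrow> e \<in> tuples (m + K * n) \<Longrightarrow> sat M e (p i) \<longleftrightarrow> P i e"
    using P unfolding definable_def by metis
  obtain q where q: "\<And>i. i \<in> I \<Longrightarrow> is_formula M (n + K * n) (q i)"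
    "\<And>i e. i \<in> I \<Longrightarrow> e \<in> tuples (n + K * n) \<Longrightarrow> sat M e (q i) \<longleftrightarrow> Q i e"
    using Q unfolding definable_def by metis
  obtain c :: "_ \<Rightarrow> nat" where c: "inj_on c I"
    using finite_imp_inj_to_nat_seg[OF \<open>finite I\<close>] by blast
  \<comment> \<open>\<open>theta\<close> depends on the formula alone, so equal formulas with different indices must be
    told apart; the tautologies do this.\<close>
  define f where "f i = Conj (taut (2 * c i)) (p i)" for i
  have f: "inj_on f I" using c by (auto simp: f_def taut_inject inj_on_def)
  define T where "T = \<lparr>params = K, Psi = f ` I, theta = (\<lambda>\<psi>. q (inv_into I f \<psi>))\<rparr>"
  have T: "params T = K" "Psi T = f ` I" "\<And>i. i \<in> I \<Longrightarrow> theta T (f i) = q i"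
    using f by (auto simp: T_def)
  show ?thesis
  proof (intro exI[of _ T] conjI allI impI)
    show "params T = K" by (fact T)
    show "is_formula_set M m (K * n) (Psi T)"
      using \<open>finite I\<close> p(1) by (auto simp: is_formula_set_def T f_def is_formula_taut)
    show "\<forall>\<psi>\<in>Psi T. is_formula M (n + K * n) (theta T \<psi>)" using q(1) by (auto simp: T)
    fix B :: "'a list set" assume B: "B \<subseteq> tuples n"
    have len: "length (concat bs) = K * n" if "length bs = K" "set bs \<subseteq> B" for bs
      using that B length_concat_tuples[of bs n] by blast
    have 1: "def_set M m (f i) (concat bs) = {a \<in> tuples m. P i (a @ concat bs)}"
      if "i \<in> I" "length bs = K" "set bs \<subseteq> B" for i bs
      using that len p(2)[of i] by (auto simp: def_set_def f_def sat_taut_even tuples_def)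
    have 2: "(\<exists>b\<in>B. sat M (b @ concat bs) (theta T (f i))) \<longleftrightarrow> (\<exists>b\<in>B. Q i (b @ concat bs))"
      if "i \<in> I" "length bs = K" "set bs \<subseteq> B" for i bs
      using that len q(2)[of i] B by (auto simp: T tuples_def subset_iff)
    show "cells M m T B = {{a \<in> tuples m. P i (a @ concat bs)} |i bs.
          i \<in> I \<and> length bs = K \<and> set bs \<subseteq> B \<and> \<not> (\<exists>b\<in>B. Q i (b @ concat bs))}"
      unfolding cells_def T(1,2) using 1 2 by blast
  qed
qed


text \<open>A list over an image of \<open>B\<close> is \<open>map g us\<close> for a list
  \<open>us\<close> over \<open>B\<close>, so parameters can be traced back to \<open>B\<close>.
  This serves the parameter sets of the fibres as well as those of the base.\<close>

lemma cells_image: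
  "cells M m T (g ` B) =
     {def_set M m \<chi> (concat (map g us)) |\<chi> us.
        \<chi> \<in> Psi T \<and> length us = params T \<and> set us \<subseteq> B \<and>
        \<not> (\<exists>b\<in>B. sat M (g b @ concat (map g us)) (theta T \<chi>))}"
proof -
  have "{bs. length bs = params T \<and> set bs \<subseteq> g ` B} =
      map g ` {us. length us = params T \<and> set us \<subseteq> B}"
    using lists_image[of g B] by (auto simp: lists_eq_set image_iff set_eq_iff)
  then have "length bs = params T \<and> set bs \<subseteq> g ` B \<longleftrightarrow>
      (\<exists>us. bs = map g us \<and> length us = params T \<and> set us \<subseteq> B)" for bs
    by (auto simp: set_eq_iff image_iff)
  note lists = this
  have "X \<in> cells M m T (g ` B) \<longleftrightarrow>
      (\<exists>\<chi>\<in>Psi T. \<exists>bs. (length bs = params T \<and> set bs \<subseteq> g ` B) \<and>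
        X = def_set M m \<chi> (concat bs) \<and> \<not> (\<exists>b\<in>B. sat M (g b @ concat bs) (theta T \<chi>)))" for X
    unfolding cells_def by blast
  then show ?thesis unfolding lists by blast
qed

section \<open>Adding one variable\<close>

text \<open>Both hypotheses range over all parameter lengths: \<open>one\<close> is applied with
  length \<open>m + n\<close>, \<open>hyp\<close> with length \<open>n + k * n\<close>. Having the
  same \<open>k\<close> and \<open>s\<close> for all formula sets makes the new exponent uniform
  too.\<close>

lemma distal_cell_decomp_Suc:
  fixes M :: "('f, 'r, 'a) fo_structure"
  assumes one: "\<And>n \<Phi>. is_formula_set M 1 n \<Phi> \<Longrightarrow>
      \<exists>T. distal_cell_decomp M 1 n \<Phi> T \<and> params T = k"
    and hyp: "\<And>n \<Phi>. is_formula_set M m n \<Phi> \<Longrightarrow>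
      \<exists>T. distal_cell_decomp M m n \<Phi> T \<and> has_exponent M m n T s"
    and \<Phi>: "is_formula_set M (Suc m) n \<Phi>"
  shows "\<exists>T. distal_cell_decomp M (Suc m) n \<Phi> T \<and> has_exponent M (Suc m) n T (real k + s)"
proof -
  \<comment> \<open>The same formulas, partitioned after the first variable: the other
    \<open>m\<close> variables of the object tuple become parameters, and no renaming is
    required.\<close>
  have "is_formula_set M 1 (m + n) \<Phi>" using \<Phi> by (simp add: is_formula_set_def)
  then obtain T1 where T1: "distal_cell_decomp M 1 (m + n) \<Phi> T1" and k: "params T1 = k"
    using one by blast
  have fin1: "finite (Psi T1)"
    and Psi1: "\<And>\<psi>. \<psi> \<in> Psi T1 \<Longrightarrow> is_formula M (1 + k * (m + n)) \<psi>"
    and theta1: "\<And>\<psi>. \<psi> \<in> Psi T1 \<Longrightarrow> is_formula M (m + n + k * (m + n)) (theta T1 \<psi>)"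
    using T1 k by (auto simp: distal_cell_decomp_def is_formula_set_def)

  \<comment> \<open>Formulas over the base that describe the fibre cells\<close>
  define N where "N = m + (n + k * n)"
  define spread :: "'a list \<Rightarrow> 'a list list \<Rightarrow> 'a list" where
    "spread x cs = concat (map ((@) x) cs)" for x cs

  \<comment> \<open>This gives \<open>f \<psi>\<close>, which says at \<open>(x, b, cs)\<close> that
    \<open>b\<close> excludes the cell of \<open>\<psi>\<close> with parameters \<open>cs\<close>
    from the fibre over \<open>x\<close>. The copies of \<open>x\<close> in
    \<open>spread x cs\<close> are merged into one, so that \<open>x\<close> can serve as the object
    variable.\<close>
  have "\<exists>\<phi>. is_formula M N \<phi> \<and> (\<forall>x b cs. x \<in> tuples m \<longrightarrow> b \<in> tuples n \<longrightarrow> set cs \<subseteq> tuples n \<longrightarrow>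
      length cs = k \<longrightarrow> (sat M (x @ b @ concat cs) \<phi> \<longleftrightarrow> sat M (x @ b @ spread x cs) (theta T1 \<psi>)))"
    if "\<psi> \<in> Psi T1" for \<psi>
  proof -
    have "definable M N (\<lambda>e. sat M ((slice 0 m e @ slice m n e) @
        concat (map (\<lambda>j. slice 0 m e @ slice (m + n + j * n) n e) [0..<k])) (theta T1 \<psi>))"
      using that theta1
      by (intro definable_sat[where N' = "m + n + k * (m + n)"] coord_map_append coord_map_concat
          coord_map_slice[OF coord_map_id]) (auto simp: N_def dest!: block_le[of _ k n])
    then obtain \<phi> where \<phi>: "is_formula M N \<phi>" "\<And>e. e \<in> tuples N \<Longrightarrow> sat M e \<phi> \<longleftrightarrow>
        sat M ((slice 0 m e @ slice m n e) @
        concat (map (\<lambda>j. slice 0 m e @ slice (m + n + j * n) n e) [0..<k])) (theta T1 \<psi>)"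
      unfolding definable_def by blast
    have "sat M (x @ b @ concat cs) \<phi> \<longleftrightarrow> sat M (x @ b @ spread x cs) (theta T1 \<psi>)"
      if "x \<in> tuples m" "b \<in> tuples n" "set cs \<subseteq> tuples n" "length cs = k" for x b cs
    proof -
      let ?e = "x @ b @ concat cs"
      have "?e \<in> tuples N" "slice 0 m ?e = x" "slice m n ?e = b"
        using that by (auto simp: tuples_def N_def slice_def length_concat_tuples)
      moreover have "map (\<lambda>j. x @ slice (m + n + j * n) n ?e) [0..<k] = map ((@) x) cs"
        by (rule map_slice_concat'[where p = "x @ b" and q = "[]"])
           (use that in \<open>auto simp: tuples_def\<close>)
      ultimately show ?thesis using \<phi>(2)[of ?e] by (simp add: spread_def)
    qed
    with \<phi>(1) show ?thesis by blast
  qed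
  then obtain f where f: "\<And>\<psi>. \<psi> \<in> Psi T1 \<Longrightarrow> is_formula M N (f \<psi>)"
    "\<And>\<psi> x b cs. \<psi> \<in> Psi T1 \<Longrightarrow> x \<in> tuples m \<Longrightarrow> b \<in> tuples n \<Longrightarrow> set cs \<subseteq> tuples n \<Longrightarrow>
      length cs = k \<Longrightarrow> sat M (x @ b @ concat cs) (f \<psi>) \<longleftrightarrow> sat M (x @ b @ spread x cs) (theta T1 \<psi>)"
    by metis

  \<comment> \<open>This gives \<open>g \<psi> \<phi>\<close>, which says that the fibre of
    \<open>\<psi>\<close> over \<open>x\<close> is not contained in that of \<open>\<phi>\<close>.
    As an uncrossed nonempty fibre lies on one side of \<open>\<phi>\<close>, this decides the
    side.\<close>
  have "\<exists>\<phi>'. is_formula M N \<phi>' \<and> (\<forall>x b cs. x \<in> tuples m \<longrightarrow> b \<in> tuples n \<longrightarrow> set cs \<subseteq> tuples n \<longrightarrow>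
      length cs = k \<longrightarrow> (sat M (x @ b @ concat cs) \<phi>' \<longleftrightarrow>
        (\<exists>a. sat M (a # spread x cs) \<psi> \<and> \<not> sat M (a # x @ b) \<phi>)))"
    if "\<psi> \<in> Psi T1" "\<phi> \<in> \<Phi>" for \<psi> \<phi>
  proof -
    have "is_formula M (1 + (m + n)) \<phi>" using \<Phi> that(2) by (simp add: is_formula_set_def)
    then have "definable M (Suc N) (\<lambda>e. sat M (slice 0 1 e @
        concat (map (\<lambda>j. slice 1 m e @ slice (1 + m + n + j * n) n e) [0..<k])) \<psi> \<and>
        \<not> sat M (slice 0 (1 + (m + n)) e) \<phi>)"
      using that Psi1
      by (intro definable_conj definable_not definable_sat[where N' = "1 + (m + n)"]
          definable_sat[where N' = "1 + k * (m + n)"] coord_map_append coord_map_concat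
          coord_map_slice[OF coord_map_id]) (auto simp: N_def dest!: block_le[of _ k n])
    from definable_ex[OF this] obtain \<phi>' where \<phi>': "is_formula M N \<phi>'"
      "\<And>e. e \<in> tuples N \<Longrightarrow> sat M e \<phi>' \<longleftrightarrow> (\<exists>a. sat M (slice 0 1 (a # e) @
        concat (map (\<lambda>j. slice 1 m (a # e) @ slice (1 + m + n + j * n) n (a # e)) [0..<k])) \<psi> \<and>
        \<not> sat M (slice 0 (1 + (m + n)) (a # e)) \<phi>)"
      unfolding definable_def by blast
    have "sat M (x @ b @ concat cs) \<phi>' \<longleftrightarrow>
        (\<exists>a. sat M (a # spread x cs) \<psi> \<and> \<not> sat M (a # x @ b) \<phi>)"
      if "x \<in> tuples m" "b \<in> tuples n" "set cs \<subseteq> tuples n" "length cs = k" for x b cs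
    proof -
      let ?e = "x @ b @ concat cs"
      have "?e \<in> tuples N" "\<And>a. slice 0 1 (a # ?e) = [a]" "\<And>a. slice 1 m (a # ?e) = x"
        "\<And>a. slice 0 (1 + (m + n)) (a # ?e) = a # x @ b"
        using that by (auto simp: tuples_def N_def slice_def length_concat_tuples)
      moreover have "map (\<lambda>j. x @ slice (1 + m + n + j * n) n (a # ?e)) [0..<k] = map ((@) x) cs"
        for a
        by (rule map_slice_concat'[where p = "a # x @ b" and q = "[]"])
           (use that in \<open>auto simp: tuples_def\<close>)
      ultimately show ?thesis using \<phi>'(2)[of ?e] by (simp add: spread_def)
    qed
    with \<phi>'(1) show ?thesis by blast
  qed
  then obtain g where g: "\<And>\<psi> \<phi>. \<psi> \<in> Psi T1 \<Longrightarrow> \<phi> \<in> \<Phi> \<Longrightarrow> is_formula M N (g \<psi> \<phi>)"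
    "\<And>\<psi> \<phi> x b cs. \<psi> \<in> Psi T1 \<Longrightarrow> \<phi> \<in> \<Phi> \<Longrightarrow> x \<in> tuples m \<Longrightarrow> b \<in> tuples n \<Longrightarrow>
      set cs \<subseteq> tuples n \<Longrightarrow> length cs = k \<Longrightarrow> sat M (x @ b @ concat cs) (g \<psi> \<phi>) \<longleftrightarrow>
        (\<exists>a. sat M (a # spread x cs) \<psi> \<and> \<not> sat M (a # x @ b) \<phi>)"
    by metis

  \<comment> \<open>Decomposition of the base\<close>
  define \<Phi>2 where "\<Phi>2 = f ` Psi T1 \<union> (\<lambda>(\<psi>, \<phi>). g \<psi> \<phi>) ` (Psi T1 \<times> \<Phi>)"
  have "is_formula_set M m (n + k * n) \<Phi>2"
    using fin1 \<Phi> f(1) g(1) by (auto simp: is_formula_set_def \<Phi>2_def N_def)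
  then obtain T2 where T2: "distal_cell_decomp M m (n + k * n) \<Phi>2 T2"
    and exp2: "has_exponent M m (n + k * n) T2 s"
    using hyp by blast
  define l where "l = params T2"
  have fin2: "finite (Psi T2)"
    and Psi2: "\<And>\<chi>. \<chi> \<in> Psi T2 \<Longrightarrow> is_formula M (m + l * (n + k * n)) \<chi>"
    and theta2: "\<And>\<chi>. \<chi> \<in> Psi T2 \<Longrightarrow> is_formula M (n + k * n + l * (n + k * n)) (theta T2 \<chi>)"
    using T2 by (auto simp: distal_cell_decomp_def is_formula_set_def l_def)

  \<comment> \<open>Data of the combined decomposition\<close>
  define tail :: "'a list list \<Rightarrow> 'a list \<Rightarrow> 'a list" where "tail cs u = u @ concat cs" for cs u
  \<comment> \<open>The part above \<open>D\<close> of the set cut out by \<open>\<psi>\<close>: the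
    union over \<open>x\<close> in \<open>D\<close> of the fibres with parameters
    \<open>spread x cs\<close>.\<close>
  define cell where
    "cell \<psi> cs D = {a \<in> tuples (Suc m). tl a \<in> D \<and> sat M (hd a # spread (tl a) cs) \<psi>}" for \<psi> cs D
  \<comment> \<open>Environment: one fibre coordinate, \<open>m\<close> base coordinates,
    \<open>k\<close> blocks \<open>cs\<close>, then \<open>l\<close> blocks \<open>us\<close>. Each
    parameter of \<open>T2\<close> is one block of \<open>us\<close> followed by all of
    \<open>cs\<close>, so the latter is copied \<open>l\<close> times.\<close>
  define P where "P = (\<lambda>(\<psi>, \<chi>) e.
    sat M (slice 0 1 e @ concat (map (\<lambda>j. slice 1 m e @ slice (Suc m + j * n) n e) [0..<k])) \<psi> \<and>
    sat M (slice 1 m e @ concat (map (\<lambda>j. slice (Suc m + k * n + j * n) n e @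
      slice (Suc m) (k * n) e) [0..<l])) \<chi>)"
  \<comment> \<open>A parameter \<open>b\<close> excludes a pair if \<open>T2\<close> excludes the
    base cell by \<open>(b, cs)\<close>, or if \<open>T1\<close> excludes the fibre cell by
    \<open>b\<close> over some point \<open>x\<close> of the base cell.\<close>
  define Q where "Q = (\<lambda>(\<psi>, \<chi>) e.
    sat M ((slice 0 n e @ slice n (k * n) e) @ concat (map (\<lambda>j. slice (n + k * n + j * n) n e @
      slice n (k * n) e) [0..<l])) (theta T2 \<chi>) \<or>
    (\<exists>x\<in>tuples m.
      sat M (x @ concat (map (\<lambda>j. slice (n + k * n + j * n) n e @ slice n (k * n) e) [0..<l])) \<chi> \<and>
      sat M ((x @ slice 0 n e) @ concat (map (\<lambda>j. x @ slice (n + j * n) n e) [0..<k])) (theta T1 \<psi>)))"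
  have defP: "\<forall>i\<in>Psi T1 \<times> Psi T2. definable M (Suc m + (k + l) * n) (P i)"
  proof
    fix i assume i0: "i \<in> Psi T1 \<times> Psi T2"
    obtain \<psi> \<chi> where i: "i = (\<psi>, \<chi>)" "\<psi> \<in> Psi T1" "\<chi> \<in> Psi T2" using i0 by blast
    show "definable M (Suc m + (k + l) * n) (P i)" unfolding i P_def prod.case
      by (intro definable_conj definable_sat[OF Psi1[OF i(2)]] definable_sat[OF Psi2[OF i(3)]]
          coord_map_append coord_map_concat coord_map_slice[OF coord_map_id])
         (auto simp: add_mult_distrib dest!: block_le[of _ k n] block_le[of _ l n])
  qed
  have defQ: "\<forall>i\<in>Psi T1 \<times> Psi T2. definable M (n + (k + l) * n) (Q i)"
  proof
    fix i assume i0: "i \<in> Psi T1 \<times> Psi T2"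
    obtain \<psi> \<chi> where i: "i = (\<psi>, \<chi>)" "\<psi> \<in> Psi T1" "\<chi> \<in> Psi T2" using i0 by blast
    show "definable M (n + (k + l) * n) (Q i)" unfolding i Q_def prod.case
      by (intro definable_disj definable_bex definable_conj definable_sat[OF theta1[OF i(2)]]
          definable_sat[OF Psi2[OF i(3)]] definable_sat[OF theta2[OF i(3)]]
          coord_map_append coord_map_concat coord_map_slice[OF coord_map_id]
          coord_map_slice[OF coord_map_drop] coord_map_take)
         (auto simp: add_mult_distrib dest!: block_le[of _ k n] block_le[of _ l n])
  qed

  obtain T where T: "params T = k + l" "is_formula_set M (Suc m) ((k + l) * n) (Psi T)"
    "\<forall>\<psi>\<in>Psi T. is_formula M (n + (k + l) * n) (theta T \<psi>)"
    "\<forall>B\<subseteq>tuples n. cells M (Suc m) T B =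
       {{a \<in> tuples (Suc m). P i (a @ concat bs)} |i bs. i \<in> Psi T1 \<times> Psi T2 \<and>
          length bs = k + l \<and> set bs \<subseteq> B \<and> \<not> (\<exists>b\<in>B. Q i (b @ concat bs))}"
    using cell_decomp_of_family[OF finite_cartesian_product[OF fin1 fin2] defP defQ]
    by (elim exE conjE) (rule that)

  \<comment> \<open>The cells of the combined decomposition\<close>
  have cells_T: "cells M (Suc m) T B =
      {cell \<psi> cs D |\<psi> cs D. \<psi> \<in> Psi T1 \<and> length cs = k \<and> set cs \<subseteq> B \<and>
        D \<in> cells M m T2 (tail cs ` B) \<and>
        (\<forall>x\<in>D. \<forall>b\<in>B. \<not> sat M (x @ b @ spread x cs) (theta T1 \<psi>))}"
    if B: "B \<subseteq> tuples n" for B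
  proof -
    let ?D = "\<lambda>\<chi> cs us. def_set M m \<chi> (concat (map (tail cs) us))"
    have P: "{a \<in> tuples (Suc m). P (\<psi>, \<chi>) (a @ concat (cs @ us))} = cell \<psi> cs (?D \<chi> cs us)"
      if "length cs = k" "set cs \<subseteq> B" "length us = l" "set us \<subseteq> B" for \<psi> \<chi> cs us
    proof -
      have "P (\<psi>, \<chi>) (a @ concat (cs @ us)) \<longleftrightarrow>
        sat M (hd a # spread (tl a) cs) \<psi> \<and> sat M (tl a @ concat (map (tail cs) us)) \<chi>"
        if a: "a \<in> tuples (Suc m)" for a
      proof -
        let ?e = "a @ concat (cs @ us)"
        have len: "length (concat cs) = k * n"
          using length_concat_tuples[of cs n] \<open>set cs \<subseteq> B\<close> \<open>length cs = k\<close> B by blast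
        have "slice 0 1 ?e = [hd a]" "slice 1 m ?e = tl a" "slice (Suc m) (k * n) ?e = concat cs"
          using a len by (cases a; auto simp: tuples_def slice_def)+
        moreover have "map (\<lambda>j. tl a @ slice (Suc m + j * n) n ?e) [0..<k] = map ((@) (tl a)) cs"
          by (rule map_slice_concat'[where p = a and q = "concat us"])
             (use that B a \<open>length cs = k\<close> \<open>set cs \<subseteq> B\<close> in \<open>auto simp: tuples_def\<close>)
        moreover have "map (\<lambda>j. slice (Suc m + k * n + j * n) n ?e @ concat cs) [0..<l] =
            map (\<lambda>u. u @ concat cs) us"
          by (rule map_slice_concat'[where p = "a @ concat cs" and q = "[]"])
             (use len B a \<open>length us = l\<close> \<open>set us \<subseteq> B\<close> in \<open>auto simp: tuples_def\<close>)
        ultimately show ?thesis unfolding P_def by (simp add: spread_def tail_def[abs_def])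
      qed
      then show ?thesis by (auto simp: cell_def def_set_def tuples_def)
    qed
    have Q: "Q (\<psi>, \<chi>) (b @ concat (cs @ us)) \<longleftrightarrow>
        sat M (tail cs b @ concat (map (tail cs) us)) (theta T2 \<chi>) \<or>
        (\<exists>x\<in>?D \<chi> cs us. sat M (x @ b @ spread x cs) (theta T1 \<psi>))"
      if "length cs = k" "set cs \<subseteq> B" "length us = l" "set us \<subseteq> B" "b \<in> B" for \<psi> \<chi> cs us b
    proof -
      let ?e = "b @ concat (cs @ us)"
      have b: "length b = n" using B \<open>b \<in> B\<close> by (auto simp: tuples_def)
      have len: "length (concat cs) = k * n"
        using length_concat_tuples[of cs n] \<open>set cs \<subseteq> B\<close> \<open>length cs = k\<close> B by blast
      have "slice 0 n ?e = b" "slice n (k * n) ?e = concat cs"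
        using b len by (auto simp: slice_def)
      moreover have "map (\<lambda>j. x @ slice (n + j * n) n ?e) [0..<k] = map ((@) x) cs" for x
        by (rule map_slice_concat'[where p = b and q = "concat us"])
           (use that B b in \<open>auto simp: tuples_def\<close>)
      moreover have "map (\<lambda>j. slice (n + k * n + j * n) n ?e @ concat cs) [0..<l] =
          map (\<lambda>u. u @ concat cs) us"
        by (rule map_slice_concat'[where p = "b @ concat cs" and q = "[]"])
           (use that B b len in \<open>auto simp: tuples_def\<close>)
      ultimately show ?thesis unfolding Q_def
        by (auto simp: spread_def tail_def[abs_def] def_set_def)
    qed
    have Q': "(\<exists>b\<in>B. Q (\<psi>, \<chi>) (b @ concat (cs @ us))) \<longleftrightarrow>
        (\<exists>b\<in>B. sat M (tail cs b @ concat (map (tail cs) us)) (theta T2 \<chi>)) \<or>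
        (\<exists>x\<in>?D \<chi> cs us. \<exists>b\<in>B. sat M (x @ b @ spread x cs) (theta T1 \<psi>))"
      if "length cs = k" "set cs \<subseteq> B" "length us = l" "set us \<subseteq> B" for \<psi> \<chi> cs us
      using Q[OF that] by blast
    \<comment> \<open>A parameter list of length \<open>k + l\<close> is cut after \<open>k\<close>
      entries into the fibre parameters \<open>cs\<close> and the base parameters
      \<open>us\<close>.\<close>
    have "cells M (Suc m) T B =
      {{a \<in> tuples (Suc m). P (\<psi>, \<chi>) (a @ concat (cs @ us))} |\<psi> \<chi> cs us.
          \<psi> \<in> Psi T1 \<and> \<chi> \<in> Psi T2 \<and> length cs = k \<and> set cs \<subseteq> B \<and> length us = l \<and> set us \<subseteq> B \<and>
          \<not> (\<exists>b\<in>B. Q (\<psi>, \<chi>) (b @ concat (cs @ us)))}" (is "_ = ?S")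
    proof (intro equalityI subsetI)
      fix X assume "X \<in> cells M (Suc m) T B"
      then obtain \<psi> \<chi> bs where *: "X = {a \<in> tuples (Suc m). P (\<psi>, \<chi>) (a @ concat bs)}"
        "\<psi> \<in> Psi T1" "\<chi> \<in> Psi T2" "length bs = k + l" "set bs \<subseteq> B"
        "\<not> (\<exists>b\<in>B. Q (\<psi>, \<chi>) (b @ concat bs))"
        unfolding T(4)[rule_format, OF B] by blast
      moreover have "set (take k bs) \<subseteq> B" "set (drop k bs) \<subseteq> B"
        using * set_take_subset set_drop_subset by fast+
      moreover have "bs = take k bs @ drop k bs" "length (take k bs) = k" "length (drop k bs) = l"
        using * by auto
      ultimately show "X \<in> ?S" unfolding mem_Collect_eq
        by (intro exI[of _ \<psi>] exI[of _ \<chi>] exI[of _ "take k bs"] exI[of _ "drop k bs"]) auto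
    next
      fix X assume "X \<in> ?S"
      then obtain \<psi> \<chi> cs us where *:
        "X = {a \<in> tuples (Suc m). P (\<psi>, \<chi>) (a @ concat (cs @ us))}"
        "\<psi> \<in> Psi T1" "\<chi> \<in> Psi T2" "length cs = k" "set cs \<subseteq> B" "length us = l" "set us \<subseteq> B"
        "\<not> (\<exists>b\<in>B. Q (\<psi>, \<chi>) (b @ concat (cs @ us)))"
        by blast
      then show "X \<in> cells M (Suc m) T B" unfolding T(4)[rule_format, OF B] mem_Collect_eq
        by (intro exI[of _ "(\<psi>, \<chi>)"] exI[of _ "cs @ us"]) auto
    qed
    also have "\<dots> = {cell \<psi> cs (?D \<chi> cs us) |\<psi> \<chi> cs us.
          \<psi> \<in> Psi T1 \<and> \<chi> \<in> Psi T2 \<and> length cs = k \<and> set cs \<subseteq> B \<and> length us = l \<and> set us \<subseteq> B \<and>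
          \<not> (\<exists>b\<in>B. sat M (tail cs b @ concat (map (tail cs) us)) (theta T2 \<chi>)) \<and>
          (\<forall>x\<in>?D \<chi> cs us. \<forall>b\<in>B. \<not> sat M (x @ b @ spread x cs) (theta T1 \<psi>))}"
      by (intro Collect_cong ex_cong1) (metis (no_types, lifting) P Q')
    also have "\<dots> = {cell \<psi> cs D |\<psi> cs D. \<psi> \<in> Psi T1 \<and> length cs = k \<and> set cs \<subseteq> B \<and>
        D \<in> cells M m T2 (tail cs ` B) \<and>
        (\<forall>x\<in>D. \<forall>b\<in>B. \<not> sat M (x @ b @ spread x cs) (theta T1 \<psi>))}"
      unfolding cells_image l_def[symmetric] by blast
    finally show ?thesis .
  qed

  \<comment> \<open>Parameter sets of the base and of the fibres\<close>
  have tail_B: "finite (tail cs ` B) \<and> tail cs ` B \<noteq> {} \<and> tail cs ` B \<subseteq> tuples (n + k * n) \<and>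
      card (tail cs ` B) = card B"
    if "finite B" "B \<noteq> {}" "B \<subseteq> tuples n" "length cs = k" "set cs \<subseteq> B" for B cs
  proof -
    have "length (concat cs) = k * n" using length_concat_tuples[of cs n] that by blast
    moreover have "card (tail cs ` B) = card B" by (rule card_image) (simp add: inj_on_def tail_def)
    ultimately show ?thesis using that by (auto simp: tail_def tuples_def)
  qed
  have fibre_B: "finite ((@) x ` B) \<and> (@) x ` B \<noteq> {} \<and> (@) x ` B \<subseteq> tuples (m + n)"
    if "finite B" "B \<noteq> {}" "B \<subseteq> tuples n" "x \<in> tuples m" for B x
    using that by (auto simp: tuples_def)

  \<comment> \<open>Covering and absence of crossings\<close>
  have "distal_cell_decomp M (Suc m) n \<Phi> T"
    unfolding distal_cell_decomp_def T(1)
  proof (intro conjI allI impI)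
    show "is_formula_set M (Suc m) ((k + l) * n) (Psi T)"
      "\<forall>\<psi>\<in>Psi T. is_formula M (n + (k + l) * n) (theta T \<psi>)" by (fact T)+
    fix B :: "'a list set" assume "finite B \<and> B \<noteq> {} \<and> B \<subseteq> tuples n"
    then have B: "finite B" "B \<noteq> {}" "B \<subseteq> tuples n" by auto
    have cells2: "\<Union> (cells M m T2 (tail cs ` B)) = tuples m"
      "\<And>D. D \<in> cells M m T2 (tail cs ` B) \<Longrightarrow> \<not> crossed M m \<Phi>2 (tail cs ` B) D"
      if "length cs = k" "set cs \<subseteq> B" for cs
      using T2 tail_B[OF B that] unfolding distal_cell_decomp_def by blast+
    have cells1: "\<Union> (cells M 1 T1 ((@) x ` B)) = tuples 1"
      "\<And>D. D \<in> cells M 1 T1 ((@) x ` B) \<Longrightarrow> \<not> crossed M 1 \<Phi> ((@) x ` B) D"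
      if "x \<in> tuples m" for x
      using T1 fibre_B[OF B that] unfolding distal_cell_decomp_def by blast+
    \<comment> \<open>Being uncrossed by \<open>\<Phi>2\<close>, a base cell gives each
      \<open>f \<psi>\<close> and \<open>g \<psi> \<phi>\<close> a constant truth value, for fixed
      \<open>b\<close> and \<open>cs\<close>.\<close>
    have const: "sat M (x @ b @ concat cs) \<phi> \<longleftrightarrow> sat M (x' @ b @ concat cs) \<phi>"
      if "length cs = k" "set cs \<subseteq> B" "D \<in> cells M m T2 (tail cs ` B)" "\<phi> \<in> \<Phi>2" "b \<in> B"
        "x \<in> D" "x' \<in> D" for cs D \<phi> b x x'
      using not_crossedD[OF cells2(2)[OF that(1-3)] cells_subset[OF that(3)] that(4) _ that(6,7),
          of "tail cs b"] that(5) by (simp add: tail_def)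

    show "\<Union> (cells M (Suc m) T B) = tuples (Suc m)"
    proof
      show "\<Union> (cells M (Suc m) T B) \<subseteq> tuples (Suc m)" using cells_subset by blast
      show "tuples (Suc m) \<subseteq> \<Union> (cells M (Suc m) T B)"
      proof
        fix v :: "'a list" assume "v \<in> tuples (Suc m)"
        then obtain a x where v: "v = a # x" and x: "x \<in> tuples m"
          by (auto simp: tuples_def length_Suc_conv)
        \<comment> \<open>The fibre cell around \<open>a\<close> is taken first; its parameters
          \<open>cs\<close> then determine which base decomposition supplies
          \<open>D\<close>.\<close>
        have "[a] \<in> \<Union> (cells M 1 T1 ((@) x ` B))" unfolding cells1(1)[OF x] by (simp add: tuples_def)
        then obtain \<psi> cs where \<psi>: "\<psi> \<in> Psi T1" and cs: "length cs = k" "set cs \<subseteq> B"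
          and a: "sat M (a # spread x cs) \<psi>"
          and th: "\<not> (\<exists>b\<in>B. sat M (x @ b @ spread x cs) (theta T1 \<psi>))"
          unfolding cells_image k by (auto simp: def_set_def spread_def)
        have csn: "set cs \<subseteq> tuples n" using cs B by blast
        obtain D where D: "D \<in> cells M m T2 (tail cs ` B)" "x \<in> D"
          using cells2(1)[OF cs] x by blast
        \<comment> \<open>Validity of the fibre cell is known over \<open>x\<close> only; constancy
          of \<open>f \<psi>\<close> carries it to all of \<open>D\<close>.\<close>
        have "\<not> sat M (x' @ b @ spread x' cs) (theta T1 \<psi>)" if "x' \<in> D" "b \<in> B" for x' b
        proof -
          have "x' \<in> tuples m" "b \<in> tuples n" using cells_subset[OF D(1)] that B by blast+
          moreover have "f \<psi> \<in> \<Phi>2" using \<psi> by (simp add: \<Phi>2_def)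
          ultimately show ?thesis
            using const[OF cs D(1) _ that(2,1) D(2)] f(2)[OF \<psi>] th that x csn cs(1) by blast
        qed
        then have "cell \<psi> cs D \<in> cells M (Suc m) T B"
          unfolding cells_T[OF B(3)] using \<psi> cs D by blast
        moreover have "v \<in> cell \<psi> cs D" using v x a D by (simp add: cell_def tuples_def)
        ultimately show "v \<in> \<Union> (cells M (Suc m) T B)" by blast
      qed
    qed

    show "\<forall>\<Delta>\<in>cells M (Suc m) T B. \<not> crossed M (Suc m) \<Phi> B \<Delta>"
    proof
      fix \<Delta> assume "\<Delta> \<in> cells M (Suc m) T B"
      then obtain \<psi> cs D where \<Delta>: "\<Delta> = cell \<psi> cs D" and \<psi>: "\<psi> \<in> Psi T1"
        and cs: "length cs = k" "set cs \<subseteq> B" and D: "D \<in> cells M m T2 (tail cs ` B)"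
        and th: "\<And>x b. x \<in> D \<Longrightarrow> b \<in> B \<Longrightarrow> \<not> sat M (x @ b @ spread x cs) (theta T1 \<psi>)"
        unfolding cells_T[OF B(3)] by blast
      have csn: "set cs \<subseteq> tuples n" using cs B by blast
      \<comment> \<open>One implication suffices: a crossing provides a point satisfying
        \<open>\<phi>\<close> and one failing it.\<close>
      have "sat M (v' @ b) \<phi>" if "\<phi> \<in> \<Phi>" "b \<in> B" and v\<Delta>: "v \<in> \<Delta>" "v' \<in> \<Delta>"
        and pos: "sat M (v @ b) \<phi>" for \<phi> b v v'
      proof (rule ccontr)
        assume neg: "\<not> sat M (v' @ b) \<phi>"
        obtain a x where v: "v = a # x" "x \<in> D" "sat M (a # spread x cs) \<psi>"
          using v\<Delta>(1) unfolding \<Delta> cell_def by (auto simp: tuples_def length_Suc_conv)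
        obtain a' x' where v': "v' = a' # x'" "x' \<in> D" "sat M (a' # spread x' cs) \<psi>"
          using v\<Delta>(2) unfolding \<Delta> cell_def by (auto simp: tuples_def length_Suc_conv)
        have xs: "x \<in> tuples m" "x' \<in> tuples m" using v(2) v'(2) cells_subset[OF D] by blast+
        have b: "b \<in> tuples n" using \<open>b \<in> B\<close> B by blast
        have "g \<psi> \<phi> \<in> \<Phi>2" using \<psi> \<open>\<phi> \<in> \<Phi>\<close> by (auto simp: \<Phi>2_def)
        note eq = const[OF cs D this \<open>b \<in> B\<close> v(2) v'(2)]
        \<comment> \<open>The points \<open>v\<close> and \<open>v'\<close> may lie over different
          base points. Since \<open>a'\<close> witnesses \<open>g \<psi> \<phi>\<close> at
          \<open>x'\<close>, constancy on \<open>D\<close> yields a witness \<open>c\<close> over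
          \<open>x\<close>, and then \<open>a\<close> and \<open>c\<close> disagree on
          \<open>\<phi>\<close> within one fibre cell.\<close>
        have "sat M (x' @ b @ concat cs) (g \<psi> \<phi>)"
          unfolding g(2)[OF \<psi> \<open>\<phi> \<in> \<Phi>\<close> xs(2) b csn cs(1)] using v' neg by auto
        then obtain c where c: "sat M (c # spread x cs) \<psi>" "\<not> sat M (c # x @ b) \<phi>"
          using eq g(2)[OF \<psi> \<open>\<phi> \<in> \<Phi>\<close> xs(1) b csn cs(1)] by blast
        let ?E = "def_set M 1 \<psi> (spread x cs)"
        have E: "?E \<in> cells M 1 T1 ((@) x ` B)"
          unfolding cells_image k spread_def using \<psi> cs th[OF v(2)]
          by (auto simp: spread_def)
        have "sat M ([a] @ x @ b) \<phi> \<longleftrightarrow> sat M ([c] @ x @ b) \<phi>"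
          by (rule not_crossedD[OF cells1(2)[OF xs(1) E] cells_subset[OF E] \<open>\<phi> \<in> \<Phi>\<close>])
             (use v(3) c(1) \<open>b \<in> B\<close> in \<open>auto simp: def_set_def tuples_def\<close>)
        then show False using c(2) v(1) pos by simp
      qed
      then show "\<not> crossed M (Suc m) \<Phi> B \<Delta>"
        unfolding crossed_def def_set_def \<Delta> cell_def by blast
    qed
  qed

  \<comment> \<open>The exponent\<close>
  moreover have "has_exponent M (Suc m) n T (real k + s)"
  proof -
    obtain C where C: "\<And>B. finite B \<Longrightarrow> B \<noteq> {} \<Longrightarrow> B \<subseteq> tuples (n + k * n) \<Longrightarrow>
        real (card (cells M m T2 B)) \<le> C * real (card B) powr s"
      using exp2 unfolding has_exponent_def by blast
    have "real (card (cells M (Suc m) T B)) \<le>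
        real (card (Psi T1)) * C * real (card B) powr (real k + s)"
      if B: "finite B" "B \<noteq> {}" "B \<subseteq> tuples n" for B
    proof -
      let ?L = "{cs. set cs \<subseteq> B \<and> length cs = k}"
      \<comment> \<open>For fixed \<open>\<psi>\<close> and \<open>cs\<close> a cell is determined
        by \<open>D\<close>, so the cells of \<open>T2\<close> bound their number.\<close>
      let ?S = "\<lambda>(\<psi>, cs). cell \<psi> cs ` cells M m T2 (tail cs ` B)"
      have finL: "finite ?L" using B finite_lists_length_eq by blast
      have fin: "finite (Psi T1 \<times> ?L)" using fin1 finL by simp
      have fc: "finite (cells M m T2 (tail cs ` B))" for cs
        using finite_cells[OF fin2] B(1) by blast
      have pos: "real (card B) > 0" using B by (simp add: card_gt_0_iff)
      have "cells M (Suc m) T B \<subseteq> \<Union> (?S ` (Psi T1 \<times> ?L))"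
        unfolding cells_T[OF B(3)] by fastforce
      moreover have "finite (\<Union> (?S ` (Psi T1 \<times> ?L)))" using fin fc by auto
      ultimately have "card (cells M (Suc m) T B) \<le> card (\<Union> (?S ` (Psi T1 \<times> ?L)))"
        by (rule card_mono[rotated])
      also have "\<dots> \<le> (\<Sum>p\<in>Psi T1 \<times> ?L. card (?S p))" by (rule card_UN_le[OF fin])
      finally have "real (card (cells M (Suc m) T B)) \<le> (\<Sum>p\<in>Psi T1 \<times> ?L. real (card (?S p)))"
        by (simp flip: of_nat_sum)
      \<comment> \<open>\<open>C\<close> comes from \<open>T2\<close> alone, and every
        \<open>cs\<close> gives a parameter set of size \<open>card B\<close>, so one bound fits all
        summands.\<close>
      also have "\<dots> \<le> (\<Sum>p\<in>Psi T1 \<times> ?L. C * real (card B) powr s)"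
      proof (rule sum_mono)
        fix p assume "p \<in> Psi T1 \<times> ?L"
        then obtain \<psi> cs where p: "p = (\<psi>, cs)" "length cs = k" "set cs \<subseteq> B" by auto
        have "card (?S p) \<le> card (cells M m T2 (tail cs ` B))"
          unfolding p(1) using card_image_le[OF fc] by simp
        also have "real \<dots> \<le> C * real (card B) powr s"
          using C[of "tail cs ` B"] tail_B[OF B p(2,3)] by simp
        finally show "real (card (?S p)) \<le> C * real (card B) powr s" by simp
      qed
      \<comment> \<open>There are \<open>card (Psi T1)\<close> times \<open>card B ^ k\<close>
        summands; positivity of \<open>card B\<close> turns this power into
        \<open>powr\<close>.\<close>
      also have "\<dots> = real (card (Psi T1)) * C * real (card B) powr (real k + s)"
        using pos B(1)
        by (simp add: card_cartesian_product card_lists_length_eq powr_add powr_realpow mult_ac)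
      finally show ?thesis .
    qed
    then show ?thesis unfolding has_exponent_def by blast
  qed
  ultimately show ?thesis by blast
qed

text \<open>For a nonempty \<open>B\<close> the base of the power is at least \<open>1\<close>. The
  absolute value is taken because \<open>C\<close> may be negative.\<close>

lemma has_exponent_mono:
  assumes "has_exponent M m n T r'" "r' \<le> r"
  shows "has_exponent M m n T r"
proof -
  obtain C where C: "\<And>B. finite B \<Longrightarrow> B \<noteq> {} \<Longrightarrow> B \<subseteq> tuples n \<Longrightarrow>
      real (card (cells M m T B)) \<le> C * real (card B) powr r'"
    using assms(1) unfolding has_exponent_def by blast
  have "real (card (cells M m T B)) \<le> \<bar>C\<bar> * real (card B) powr r"
    if "finite B" "B \<noteq> {}" "B \<subseteq> tuples n" for B
  proof -
    have "card B \<ge> 1" using that by (simp add: Suc_le_eq card_gt_0_iff)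
    then have "real (card B) powr r' \<le> real (card B) powr r"
      using assms(2) by (intro powr_mono) auto
    then have "C * real (card B) powr r' \<le> \<bar>C\<bar> * real (card B) powr r"
      by (intro mult_mono) auto
    then show ?thesis using C[OF that] by linarith
  qed
  then show ?thesis unfolding has_exponent_def by blast
qed

theorem theorem3p1:
  fixes M :: "('f, 'r, 'a) fo_structure" and k d0 d :: nat and r :: real
  assumes "\<forall>n \<Phi>. is_formula_set M 1 n \<Phi> \<longrightarrow>
             (\<exists>T. distal_cell_decomp M 1 n \<Phi> T \<and> params T = k)"
    and "\<forall>n \<Phi>. is_formula_set M d0 n \<Phi> \<longrightarrow>
             (\<exists>T. distal_cell_decomp M d0 n \<Phi> T \<and> (\<exists>r'\<le>r. has_exponent M d0 n T r'))"
    and "d \<ge> d0"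
  shows "\<forall>n \<Phi>. is_formula_set M d n \<Phi> \<longrightarrow>
             (\<exists>T. distal_cell_decomp M d n \<Phi> T \<and>
                  has_exponent M d n T (real k * (real d - real d0) + r))"
  using assms(3)
proof (induction d rule: dec_induct)
  case base
  \<comment> \<open>At \<open>d0\<close> the target exponent is \<open>r\<close> itself, to which
    the given exponent \<open>r'\<close> is raised.\<close>
  then show ?case using assms(2) has_exponent_mono by fastforce
next
  case (step m)
  have "real k * (real (Suc m) - real d0) + r = real k + (real k * (real m - real d0) + r)"
    by (simp add: algebra_simps)
  then show ?case using distal_cell_decomp_Suc[of M k m] assms(1) step.IH by metis
qed

end
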